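(* Let $x^*\in\mathbb{R}$, $m>0$, $\epsilon>0$ and $\delta>0$. There exists a continuous function $f\colon[x^*-\delta,x^*+\delta]\to\mathbb{R}$ such that: (1) $f(x^* )=m$ and $f(x)>m$ for every $x\ne x^*$ (so $x^*$ is a strong local minimum point); (2) $f$ is locally coercive at $x^*$; (3) for every odd $n\in\mathbb{N}$, $f(x^*-\frac{\delta}{n})=m+\frac{\epsilon}{n}$ and $f$ attains the value $m+\frac{\epsilon}{n}$ infinitely many times in $[x^*-\frac{\delta}{n},x^*-\frac{\delta}{n+1}]$; (4) there do not exist $\eta>0$ and $\bar y>m$ such that for every $y$ with $m<y<\bar y$ the set $\{x\in(x^*-\eta,x^*+\eta)\cap[x^*-\delta,x^*+\delta] : f(x)=y\}$ has exactly $2$ elements.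
   Context: A continuous function $f\colon\Omega\to\mathbb{R}$, with $\Omega\subset\mathbb{R}$ connected, is locally coercive at $x^*$ if there exists a neighborhood $(a,b)\subset\Omega$ of $x^*$ such that $\lim_{x\to a^+}f(x)=\lim_{x\to b^-}f(x)=L\in\mathbb{R}$. *)

theory Defs
  imports Complex_Main
begin

text \<open>
  A function on \<open>\<Omega>\<close> is a total function of which only the values on \<open>\<Omega>\<close> matter: both one-sided
  limits are taken along points of the interval \<open>{a<..<b} \<subseteq> \<Omega>\<close>, even if an endpoint is not in \<open>\<Omega>\<close>.
  No relation between \<open>L\<close> and \<open>f xs\<close> is required.
\<close>

definition locally_coercive_at :: "real set \<Rightarrow> (real \<Rightarrow> real) \<Rightarrow> real \<Rightarrow> bool" where
  "locally_coercive_at \<Omega> f xs \<longleftrightarrow>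
     connected \<Omega> \<and> continuous_on \<Omega> f \<and>
     (\<exists>a b L. xs \<in> {a<..<b} \<and> {a<..<b} \<subseteq> \<Omega> \<and>
        (f \<longlongrightarrow> L) (at_right a) \<and> (f \<longlongrightarrow> L) (at_left b))"

end

(* Under s = 1/u the points \<delta>/n become integers.  On s \<ge> 1 let
   h s = s - (distance from s to the odd integers); it is continuous, equals n on [n, n+1] for
   odd n, and s - 1 \<le> h s \<le> s.  The example is f x = m + \<epsilon> / h (\<delta> / |x - xs|): it is constant
   on each interval required in (3), and these plateaus have arbitrarily small height above m,
   which rules out (4). *)
theory Submission
  imports Defs
begin

text \<open>Since \<open>- cos (pi * s) = cos (pi * (s - 1))\<close>, this is a triangle wave: the
  distance from \<open>s\<close> to the nearest odd integer. The \<open>arccos\<close> form gives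
  continuity and the range [0, 1] at once.\<close>

definition odd_dist :: "real \<Rightarrow> real" where
  "odd_dist s = arccos (- cos (pi * s)) / pi"

lemma odd_dist_bounds: "0 \<le> odd_dist s" "odd_dist s \<le> 1"
  using arccos_bounded[of "- cos (pi * s)"] by (auto simp: odd_dist_def)

lemma isCont_odd_dist: "isCont odd_dist s"
proof -
  have "continuous_on UNIV odd_dist"
    unfolding odd_dist_def by (intro continuous_intros) auto
  then show ?thesis
    by (simp add: continuous_on_eq_continuous_at)
qed

text \<open>Shifting by an odd multiple of \<pi> flips the sign of the cosine, and
  \<open>pi * (s - real n)\<close> lies in [0, \<pi>], where \<open>arccos\<close> inverts
  \<open>cos\<close>.\<close>

lemma odd_dist_odd:
  assumes "odd n" "real n \<le> s" "s \<le> real n + 1"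
  shows "odd_dist s = s - real n"
proof -
  have "cos (pi * s) = cos (pi * (s - real n) + pi * real n)"
    by (simp add: algebra_simps)
  also have "\<dots> = - cos (pi * (s - real n))"
    using assms(1) by (simp add: cos_add mult.commute[of pi "real n"] cos_npi sin_npi)
  finally have "odd_dist s = arccos (cos (pi * (s - real n))) / pi"
    by (simp add: odd_dist_def)
  also have "\<dots> = s - real n"
    using assms by (subst arccos_cos) auto
  finally show ?thesis .
qed

text \<open>
  For \<open>u > 0\<close> this is the reciprocal of \<open>1/u - odd_dist (1/u)\<close>; the junk value \<open>1/0 = 0\<close> is
  harmless, as it is multiplied by \<open>0\<close>.
\<close>

definition staircase :: "real \<Rightarrow> real" where
  "staircase u = u / (1 - u * odd_dist (1 / u))"

lemma staircase_denom_pos: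
  assumes "0 \<le> u" "u \<le> 1"
  shows "0 < 1 - u * odd_dist (1 / u)"
\<comment> \<open>The bound \<open>odd_dist s \<le> 1\<close> gives only a nonnegative denominator
  at \<open>u = 1\<close>; there the exact value \<open>odd_dist 1 = 0\<close> is used.\<close>
proof (cases "u = 1")
  case True
  then show ?thesis using odd_dist_odd[of 1 1] by simp
next
  case False
  have "u * odd_dist (1 / u) \<le> u * 1"
    using assms odd_dist_bounds by (intro mult_left_mono) auto
  then show ?thesis using False assms by simp
qed

lemma staircase_pos: "0 < u \<Longrightarrow> u \<le> 1 \<Longrightarrow> 0 < staircase u"
  using staircase_denom_pos[of u] by (simp add: staircase_def)

text \<open>Here \<open>1 / u\<close> lies in [n, n + 1], so the denominator equals
  \<open>u * real n\<close> and \<open>u\<close> cancels.\<close>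

lemma staircase_plateau:
  assumes "odd n" "1 / real (n + 1) \<le> u" "u \<le> 1 / real n"
  shows "staircase u = 1 / real n"
proof -
  have n: "0 < real n" using assms(1) odd_pos by simp
  have u: "0 < u" by (rule less_le_trans[OF _ assms(2)]) simp
  have "odd_dist (1 / u) = 1 / u - real n"
    using assms n u by (intro odd_dist_odd) (auto simp: field_simps)
  then have "1 - u * odd_dist (1 / u) = u * real n"
    using u by (simp add: field_simps)
  then show ?thesis
    using u n by (simp add: staircase_def)
qed

text \<open>At 0 the factor \<open>odd_dist (1 / u)\<close> oscillates but stays in [0, 1], so the
  product is squeezed by \<open>\<bar>u\<bar>\<close>.\<close>

lemma isCont_mult_odd_dist_inverse: "isCont (\<lambda>u. u * odd_dist (1 / u)) u"
proof (cases "u = 0")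
  case True
  have "((\<lambda>u. u * odd_dist (1 / u)) \<longlongrightarrow> 0) (at 0)"
    by (rule tendsto_0_le[OF tendsto_ident_at always_eventually, where K = 1])
      (use odd_dist_bounds in \<open>simp add: abs_mult mult_left_le\<close>)
  then show ?thesis using True by (simp add: isCont_def)
next
  case False
  then show ?thesis
    by (intro continuous_mult isCont_o2[OF _ isCont_odd_dist] continuous_intros) auto
qed

lemma continuous_on_staircase: "continuous_on {0..1} staircase"
  unfolding staircase_def
proof (intro continuous_on_divide continuous_on_diff)
  show "continuous_on {0..1} (\<lambda>u. u * odd_dist (1 / u))"
    by (intro continuous_at_imp_continuous_on ballI isCont_mult_odd_dist_inverse)
  show "\<forall>u\<in>{0..1}. 1 - u * odd_dist (1 / u) \<noteq> 0"
    using staircase_denom_pos by force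
qed (intro continuous_intros)+

theorem mainTheorem3:
  fixes xs m \<epsilon> \<delta> :: real
  assumes "m > 0" and "\<epsilon> > 0" and "\<delta> > 0"
  shows "\<exists>f :: real \<Rightarrow> real.
    continuous_on {xs - \<delta>..xs + \<delta>} f \<and>
    (f xs = m \<and> (\<forall>x\<in>{xs - \<delta>..xs + \<delta>}. x \<noteq> xs \<longrightarrow> f x > m)) \<and>
    locally_coercive_at {xs - \<delta>..xs + \<delta>} f xs \<and>
    (\<forall>n :: nat. odd n \<longrightarrow>
       f (xs - \<delta> / real n) = m + \<epsilon> / real n \<and>
       infinite {x \<in> {xs - \<delta> / real n..xs - \<delta> / real (n + 1)}. f x = m + \<epsilon> / real n}) \<and>
    \<not> (\<exists>\<eta> ybar :: real. \<eta> > 0 \<and> ybar > m \<and>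
         (\<forall>y. m < y \<and> y < ybar \<longrightarrow>
            card {x \<in> {xs - \<eta><..<xs + \<eta>} \<inter> {xs - \<delta>..xs + \<delta>}. f x = y} = 2))"
proof -
  define f where "f = (\<lambda>x. m + \<epsilon> * staircase (\<bar>x - xs\<bar> / \<delta>))"
  have cont: "continuous_on {xs - \<delta>..xs + \<delta>} f"
    unfolding f_def using assms
    by (intro continuous_intros continuous_on_compose2[OF continuous_on_staircase])
      (auto simp: field_simps abs_le_iff)
  have min: "f xs = m"
    by (simp add: f_def staircase_def)
  have strict: "f x > m" if "x \<in> {xs - \<delta>..xs + \<delta>}" "x \<noteq> xs" for x
    using staircase_pos[of "\<bar>x - xs\<bar> / \<delta>"] that assms by (auto simp: f_def abs_le_iff)
  \<comment> \<open>The neighborhood is the whole open interval. As \<open>f\<close> is symmetric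
    about \<open>xs\<close>, both endpoint values agree and serve as the common limit.\<close>
  have coercive: "locally_coercive_at {xs - \<delta>..xs + \<delta>} f xs"
    unfolding locally_coercive_at_def
  proof (intro conjI exI)
    show "(f \<longlongrightarrow> f (xs - \<delta>)) (at_right (xs - \<delta>))"
      using continuous_on_Icc_at_rightD[OF cont] assms by simp
    have "f (xs - \<delta>) = f (xs + \<delta>)"
      using assms by (simp add: f_def)
    then show "(f \<longlongrightarrow> f (xs - \<delta>)) (at_left (xs + \<delta>))"
      using continuous_on_Icc_at_leftD[OF cont] assms by simp
  qed (use assms cont in auto)
  have left: "x < xs" if "x \<in> {xs - \<delta> / real n..xs - \<delta> / real (n + 1)}" for n x
  proof -
    have "0 < \<delta> / real (n + 1)" using assms by simp
    then show ?thesis using that unfolding atLeastAtMost_iff by linarith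
  qed
  have plateau: "f x = m + \<epsilon> / real n"
    if "odd n" "x \<in> {xs - \<delta> / real n..xs - \<delta> / real (n + 1)}" for n x
  proof -
    \<comment> \<open>The interval lies left of \<open>xs\<close>, so rescaling by \<delta> carries
      it to [1/(n+1), 1/n], a plateau of \<open>staircase\<close>.\<close>
    have "\<bar>x - xs\<bar> = xs - x" using left[OF that(2)] by simp
    moreover have "0 < real n" using that odd_pos by simp
    ultimately have "staircase (\<bar>x - xs\<bar> / \<delta>) = 1 / real n"
      using that assms by (intro staircase_plateau) (auto simp: field_simps)
    then show ?thesis by (simp add: f_def)
  qed
  have width: "xs - \<delta> / real n < xs - \<delta> / real (n + 1)" if "odd n" for n
    using that assms odd_pos[of n] by (simp add: field_simps)
  have inf: "infinite {x \<in> {xs - \<delta> / real n..xs - \<delta> / real (n + 1)}. f x = m + \<epsilon> / real n}"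
    if "odd n" for n
  proof -
    have "{x \<in> {xs - \<delta> / real n..xs - \<delta> / real (n + 1)}. f x = m + \<epsilon> / real n}
        = {xs - \<delta> / real n..xs - \<delta> / real (n + 1)}"
      using plateau that by auto
    then show ?thesis using infinite_Icc[OF width[OF that]] by simp
  qed
  have "False" if eta: "\<eta> > 0" and ybar: "ybar > m" and two:
    "\<forall>y. m < y \<and> y < ybar \<longrightarrow>
       card {x \<in> {xs - \<eta><..<xs + \<eta>} \<inter> {xs - \<delta>..xs + \<delta>}. f x = y} = 2" for \<eta> ybar
  proof -
    obtain k :: nat where k: "real k > max (\<delta> / \<eta>) (\<epsilon> / (ybar - m))"
      using reals_Archimedean2 by blast
    \<comment> \<open>This makes \<open>n\<close> odd and larger than \<open>k\<close>, so its
      plateau lies within \<eta> of \<open>xs\<close> and its height is below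
      \<open>ybar\<close>.\<close>
    define n where "n = 2 * k + 1"
    have n: "odd n" "1 \<le> real n" "\<delta> / \<eta> < real n" "\<epsilon> / (ybar - m) < real n"
      using k by (auto simp: n_def)
    then have small: "\<delta> / real n < \<eta>" "\<epsilon> / real n < ybar - m" "\<delta> / real n \<le> \<delta>"
      using eta ybar assms by (auto simp: field_simps)
    have sub: "{x \<in> {xs - \<delta> / real n..xs - \<delta> / real (n + 1)}. f x = m + \<epsilon> / real n}
        \<subseteq> {x \<in> {xs - \<eta><..<xs + \<eta>} \<inter> {xs - \<delta>..xs + \<delta>}. f x = m + \<epsilon> / real n}"
      using left[of _ n] small eta assms by fastforce
    have "infinite {x \<in> {xs - \<eta><..<xs + \<eta>} \<inter> {xs - \<delta>..xs + \<delta>}. f x = m + \<epsilon> / real n}"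
      using inf[OF n(1)] finite_subset[OF sub] by blast
    moreover have "m < m + \<epsilon> / real n" "m + \<epsilon> / real n < ybar"
      using small n assms by auto
    \<comment> \<open>\<open>card\<close> of an infinite set is 0 by convention, hence not
      2.\<close>
    ultimately show False using two by force
  qed
  \<comment> \<open>The point is the left endpoint of its plateau; \<open>width\<close> shows that
    the interval contains it.\<close>
  moreover have "f (xs - \<delta> / real n) = m + \<epsilon> / real n" if "odd n" for n
    using width[OF that] by (intro plateau[OF that]) auto
  ultimately show ?thesis
    using cont min strict coercive inf by (intro exI[of _ f]) blast
qed

end
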